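(* Let $n>2$ and let $X$ be a finite connected pure $n$-dimensional simplicial complex in which every $(n-1)$-face is contained in exactly $D$ faces of dimension $n$, for some fixed positive integer $D$. Let $V$ be the vertex set of $X$, let $W$ be the set of $(n-1)$-faces of $X$ (the vertex set of the embedded graph of $X$), let $\delta_{min}=\min_{v\in V}\delta(v)$, where $\delta(v)$ is the number of $(n-1)$-faces of $X$ containing $v$, let $k=\lfloor (n+1)/2\rfloor$, and let $\lambda$ be the second largest eigenvalue of the adjacency matrix of the embedded graph of $X$. Then \[\frac{2\, \delta_{min}\cdot (nD-\lambda)}{|W|\cdot n \cdot k \cdot(n+1-k)}\leq H(X).\]
   Context: A simplicial complex is pure if all its inclusion-maximal faces have the same dimension. For a finite connected pure $n$-dimensional simplicial complex $X$ with vertex set $V$, define \[H(X)=\min_{0<|A|<|V|} \frac{|V|\cdot|F(A,V\setminus A)|}{|A|\cdot|V\setminus A|},\] where $A$ ranges over nonempty proper subsets of $V$ and $F(A,V\setminus A)$ is the set of $n$-faces of $X$ that contain at least one vertex of $A$ and at least one vertex of $V\setminus A$. The embedded graph of $X$ is the graph whose vertices are the $(n-1)$-faces of $X$, two distinct $(n-1)$-faces being joined by an edge if and only if they are both contained in a common $n$-face of $X$. *)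

theory Defs
  imports Complex_Main
    "HOL-Library.Multiset"
    "HOL-Computational_Algebra.Polynomial"
    "Jordan_Normal_Form.Char_Poly"
begin

text \<open>
  A finite abstract simplicial complex is given by its set of faces. The empty set is not
  counted as a face, so that every face has a dimension in the natural numbers.
\<close>

definition finite_simplicial_complex :: "'v set set \<Rightarrow> bool" where
  "finite_simplicial_complex X \<longleftrightarrow>
     finite X \<and>
     (\<forall>s\<in>X. finite s \<and> s \<noteq> {}) \<and>
     (\<forall>s\<in>X. \<forall>t. t \<subseteq> s \<and> t \<noteq> {} \<longrightarrow> t \<in> X)"

definition vertices :: "'v set set \<Rightarrow> 'v set" where
  "vertices X = \<Union>X"

definition face_dim :: "'v set \<Rightarrow> nat" where
  "face_dim s = card s - 1"

definition faces :: "'v set set \<Rightarrow> nat \<Rightarrow> 'v set set" where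
  "faces X d = {s \<in> X. face_dim s = d}"

text \<open>The complex without faces has no dimension in this sense.\<close>

definition has_dimension :: "'v set set \<Rightarrow> nat \<Rightarrow> bool" where
  "has_dimension X n \<longleftrightarrow> X \<noteq> {} \<and> Max (face_dim ` X) = n"

definition maximal_faces :: "'v set set \<Rightarrow> 'v set set" where
  "maximal_faces X = {s \<in> X. \<forall>t\<in>X. s \<subseteq> t \<longrightarrow> t = s}"

definition pure_complex :: "'v set set \<Rightarrow> bool" where
  "pure_complex X \<longleftrightarrow>
     (\<forall>s\<in>maximal_faces X. \<forall>t\<in>maximal_faces X. face_dim s = face_dim t)"

text \<open>
  A complex is connected if any two of its vertices are joined by an edge path. No strong
  connectedness (through faces of codimension one) is required.
\<close>

definition connected_complex :: "'v set set \<Rightarrow> bool" where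
  "connected_complex X \<longleftrightarrow>
     (\<forall>u\<in>vertices X. \<forall>v\<in>vertices X. (u, v) \<in> {(x, y). {x, y} \<in> X}\<^sup>*)"

definition crossing_faces :: "'v set set \<Rightarrow> nat \<Rightarrow> 'v set \<Rightarrow> 'v set \<Rightarrow> 'v set set" where
  "crossing_faces X n A B = {s \<in> faces X n. s \<inter> A \<noteq> {} \<and> s \<inter> B \<noteq> {}}"

definition H_const :: "'v set set \<Rightarrow> nat \<Rightarrow> real" where
  "H_const X n =
     (let V = vertices X in
      Min ((\<lambda>A. real (card V) * real (card (crossing_faces X n A (V - A)))
                / (real (card A) * real (card (V - A))))
           ` {A. A \<subseteq> V \<and> 0 < card A \<and> card A < card V}))"

definition face_degree :: "'v set set \<Rightarrow> nat \<Rightarrow> 'v \<Rightarrow> nat" where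
  "face_degree X n v = card {w \<in> faces X (n - 1). v \<in> w}"

definition min_face_degree :: "'v set set \<Rightarrow> nat \<Rightarrow> nat" where
  "min_face_degree X n = Min (face_degree X n ` vertices X)"

text \<open>
  A graph is represented by its vertices together with its set of two-element edges; the
  vertex set of the embedded graph is \<open>faces X (n - 1)\<close>.
\<close>

definition embedded_edges :: "'v set set \<Rightarrow> nat \<Rightarrow> 'v set set set" where
  "embedded_edges X n =
     {{s, t} | s t. s \<in> faces X (n - 1) \<and> t \<in> faces X (n - 1) \<and> s \<noteq> t \<and>
                    (\<exists>f\<in>faces X n. s \<subseteq> f \<and> t \<subseteq> f)}"

text \<open>
  The list \<open>vs\<close> enumerates the vertices of the graph and thereby indexes rows and columns.
\<close>

definition adjacency_matrix :: "'a list \<Rightarrow> 'a set set \<Rightarrow> real mat" where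
  "adjacency_matrix vs E =
     mat (length vs) (length vs) (\<lambda>(i, j). if {vs ! i, vs ! j} \<in> E then 1 else 0)"

text \<open>
  Eigenvalues are counted with multiplicity: all real roots of the characteristic polynomial
  are listed in decreasing order. For a symmetric matrix these are all its eigenvalues, so
  the entry at index 1 exists as soon as the matrix has at least two rows.
\<close>

definition second_largest_eigenvalue :: "real mat \<Rightarrow> real" where
  "second_largest_eigenvalue M = rev (sorted_list_of_multiset (proots (char_poly M))) ! 1"

end

theory Submission
  imports Defs "HOL-Analysis.Function_Topology"
begin

text \<open>
  For a vertex set \<open>A\<close> take the test function \<open>x w = card (w \<inter> A)\<close> on the \<open>(n - 1)\<close>-faces. The
  embedded graph is \<open>n D\<close>-regular, so the spectral gap bounds \<open>(n D - \<lambda>) Var x\<close> by the sum of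
  \<open>(x s - x t)\<^sup>2\<close> over its edges. Two distinct \<open>(n - 1)\<close>-faces lie in at most one \<open>n\<close>-face, and an
  \<open>n\<close>-face with \<open>j\<close> vertices in \<open>A\<close> contributes \<open>j (n + 1 - j)\<close>, which is at most \<open>k (n + 1 - k)\<close> and
  vanishes unless the face crosses the cut. Connectedness and purity yield a crossing \<open>n\<close>-face, hence
  the integer-valued \<open>x\<close> is not constant and \<open>Var x\<close> (the unnormalised sum of squared deviations
  from the mean) is at least \<open>1/2\<close>. Together with
  \<open>\<delta>\<^sub>m\<^sub>i\<^sub>n card V \<le> n card W\<close> and \<open>4 card A card (V - A) \<le> (card V)\<^sup>2\<close> this is the claim.
\<close>

section \<open>Second eigenvalue of a symmetric matrix with constant row sums\<close>

text \<open>Vectors are functions on all naturals of which only the first \<open>m\<close> values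
  count. This gives pointwise arithmetic and lets the product topology supply compactness
  below.\<close>

definition dotp :: "nat \<Rightarrow> (nat \<Rightarrow> real) \<Rightarrow> (nat \<Rightarrow> real) \<Rightarrow> real" where
  "dotp m x y = (\<Sum>i<m. x i * y i)"

definition apply_kernel :: "nat \<Rightarrow> (nat \<Rightarrow> nat \<Rightarrow> real) \<Rightarrow> (nat \<Rightarrow> real) \<Rightarrow> nat \<Rightarrow> real" where
  "apply_kernel m a x = (\<lambda>i. \<Sum>j<m. a i j * x j)"

lemma dotp_commute: "dotp m x y = dotp m y x"
  by (simp add: dotp_def mult.commute)

lemma dotp_cong:
  "(\<And>i. i < m \<Longrightarrow> x i = x' i) \<Longrightarrow> (\<And>i. i < m \<Longrightarrow> y i = y' i) \<Longrightarrow> dotp m x y = dotp m x' y'"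
  by (simp add: dotp_def)

lemma dotp_add_right: "dotp m x (\<lambda>i. y i + z i) = dotp m x y + dotp m x z"
  by (simp add: dotp_def algebra_simps sum.distrib)

lemma dotp_scale_right: "dotp m x (\<lambda>i. c * y i) = c * dotp m x y"
  by (simp add: dotp_def algebra_simps sum_distrib_left)

lemma dotp_add_left: "dotp m (\<lambda>i. y i + z i) x = dotp m y x + dotp m z x"
  by (simp add: dotp_def algebra_simps sum.distrib)

lemma dotp_scale_left: "dotp m (\<lambda>i. c * y i) x = c * dotp m y x"
  by (simp add: dotp_def algebra_simps sum_distrib_left)

lemma dotp_sum_right: "dotp m x (\<lambda>i. \<Sum>l\<in>L. y l i) = (\<Sum>l\<in>L. dotp m x (y l))"
  unfolding dotp_def by (subst sum.swap) (simp add: sum_distrib_left)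

lemma dotp_nonneg: "dotp m x x \<ge> 0"
  by (simp add: dotp_def sum_nonneg)

lemma dotp_eq_0D: "dotp m x x = 0 \<Longrightarrow> i < m \<Longrightarrow> x i = 0"
  by (auto simp: dotp_def sum_nonneg_eq_0_iff)

lemma apply_kernel_add:
  "apply_kernel m a (\<lambda>i. x i + y i) = (\<lambda>i. apply_kernel m a x i + apply_kernel m a y i)"
  by (simp add: apply_kernel_def algebra_simps sum.distrib fun_eq_iff)

lemma apply_kernel_scale:
  "apply_kernel m a (\<lambda>i. c * x i) = (\<lambda>i. c * apply_kernel m a x i)"
  by (simp add: apply_kernel_def algebra_simps sum_distrib_left fun_eq_iff)

lemma apply_kernel_cong:
  "(\<And>i. i < m \<Longrightarrow> x i = y i) \<Longrightarrow> apply_kernel m a x = apply_kernel m a y"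
  by (simp add: apply_kernel_def fun_eq_iff)

lemma dotp_apply_kernel:
  assumes "\<And>i j. i < m \<Longrightarrow> j < m \<Longrightarrow> a i j = a j i"
  shows "dotp m x (apply_kernel m a y) = dotp m (apply_kernel m a x) y"
proof -
  have "dotp m x (apply_kernel m a y) = (\<Sum>i<m. \<Sum>j<m. a i j * x i * y j)"
    by (simp add: dotp_def apply_kernel_def sum_distrib_left algebra_simps)
  also have "\<dots> = (\<Sum>j<m. \<Sum>i<m. a i j * x i * y j)"
    by (rule sum.swap)
  also have "\<dots> = (\<Sum>j<m. \<Sum>i<m. a j i * x i * y j)"
    using assms by (intro sum.cong refl) auto
  also have "\<dots> = dotp m (apply_kernel m a x) y"
    by (simp add: dotp_def apply_kernel_def sum_distrib_right)
  finally show ?thesis .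
qed

section \<open>Extending an orthonormal family of eigenvectors\<close>

text \<open>The \<open>j\<close> given vectors, padded with zero rows, form a singular square
  matrix, and a normalised kernel vector is orthogonal to all of them.\<close>

lemma exists_orthogonal:
  assumes "j < m"
  shows "\<exists>x. dotp m x x = 1 \<and> (\<forall>l<j. dotp m (u l) x = 0) \<and> (\<forall>i\<ge>m. x i = 0)"
proof -
  define A :: "real mat" where "A = mat m m (\<lambda>(l, i). if l < j then u l i else 0)"
  have A: "A \<in> carrier_mat m m" by (simp add: A_def)
  have AT: "transpose_mat A \<in> carrier_mat m m" using A by simp
  \<comment> \<open>Row \<open>j\<close> of \<open>A\<close> is one of the zero rows, so the
    transpose kills the unit vector at \<open>j\<close>.\<close>
  have "transpose_mat A *\<^sub>v unit_vec m j = 0\<^sub>v m"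
    using assms A by (intro eq_vecI) (auto simp: A_def)
  then have "det (transpose_mat A) = 0"
    using det_0_iff_vec_prod_zero[OF AT] assms by (metis unit_vec_carrier unit_vec_nonzero)
  then have "det A = 0" using det_transpose[OF A] by simp
  then obtain v where v: "v \<in> carrier_vec m" "v \<noteq> 0\<^sub>v m" "A *\<^sub>v v = 0\<^sub>v m"
    using det_0_iff_vec_prod_zero[OF A] by blast
  define y where "y i = (if i < m then v $ i else 0)" for i
  have orth: "dotp m (u l) y = 0" if "l < j" for l
  proof -
    have "(A *\<^sub>v v) $ l = 0" using v(3) that assms by simp
    moreover have "(A *\<^sub>v v) $ l = dotp m (u l) y"
      using that assms v(1)
      by (auto simp: A_def dotp_def y_def scalar_prod_def atLeast0LessThan intro!: sum.cong)
    ultimately show ?thesis by simp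
  qed
  have "dotp m y y \<noteq> 0"
  proof
    assume "dotp m y y = 0"
    then have "v = 0\<^sub>v m"
      using v(1) dotp_eq_0D[of m y] by (intro eq_vecI) (auto simp: y_def)
    with v(2) show False by simp
  qed
  then have pos: "dotp m y y > 0" using dotp_nonneg[of m y] by linarith
  define c where "c = 1 / sqrt (dotp m y y)"
  have "c * (c * dotp m y y) = 1" using pos by (simp add: c_def)
  then show ?thesis
    using orth by (intro exI[of _ "\<lambda>i. c * y i"])
      (auto simp: dotp_scale_left dotp_scale_right, simp add: y_def)
qed

text \<open>The set is closed and lies in a product of intervals \<open>{-1..1}\<close>, which is
  compact by Tychonoff. Fixing the coordinates from \<open>m\<close> on to zero is what keeps it
  inside this product.\<close>

lemma compact_unit_sphere_orthogonal:
  "compact {x :: nat \<Rightarrow> real. dotp m x x = 1 \<and> (\<forall>l<j. dotp m (u l) x = 0) \<and> (\<forall>i\<ge>m. x i = 0)}"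
  (is "compact ?S")
proof -
  have "compactin (product_topology (\<lambda>i. euclidean) UNIV) (PiE UNIV (\<lambda>i::nat. {-1..1::real}))"
    by (subst compactin_PiE) auto
  then have K: "compact (PiE UNIV (\<lambda>i::nat. {-1..1::real}))"
    by (simp add: euclidean_product_topology)
  have cont: "continuous_on UNIV (\<lambda>x. dotp m (v x) (w x))"
    if "\<And>i. continuous_on UNIV (\<lambda>x :: nat \<Rightarrow> real. v x i)" "\<And>i. continuous_on UNIV (\<lambda>x. w x i)"
    for v w using that by (auto simp: dotp_def intro!: continuous_intros)
  have "?S = {x. dotp m x x = 1} \<inter> (\<Inter>l\<in>{..<j}. {x. dotp m (u l) x = 0}) \<inter> (\<Inter>i\<in>{m..}. {x. x i = 0})"
    by auto
  also have "closed \<dots>"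
    by (intro closed_Int closed_INT ballI closed_Collect_eq cont continuous_intros) auto
  finally have "closed ?S" .
  moreover have "?S \<subseteq> PiE UNIV (\<lambda>i::nat. {-1..1::real})"
  proof
    fix x assume x: "x \<in> ?S"
    have "\<bar>x i\<bar> \<le> 1" for i
    proof (cases "i < m")
      case True
      then have "x i * x i \<le> dotp m x x"
        unfolding dotp_def by (intro member_le_sum) auto
      with x have "(x i)\<^sup>2 \<le> 1" by (simp add: power2_eq_square)
      then show ?thesis by (simp add: abs_square_le_1)
    qed (use x in auto)
    then show "x \<in> PiE UNIV (\<lambda>i::nat. {-1..1::real})"
      by (auto simp: abs_le_iff minus_le_iff)
  qed
  ultimately show ?thesis
    using compact_Int_closed[OF K, of ?S] by (simp only: Int_absorb1)
qed

text \<open>For small \<open>t\<close> of the same sign as \<open>c\<close> the linear term would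
  win. This is the first-order condition at a maximum.\<close>

lemma quadratic_nonpos_linear_zero:
  fixes c e :: real
  assumes "\<And>t. 2 * t * c + t\<^sup>2 * e \<le> 0"
  shows "c = 0"
proof (rule ccontr)
  assume c: "c \<noteq> 0"
  \<comment> \<open>This \<open>t\<close> satisfies
    \<open>t\<^sup>2 * (\<bar>e\<bar> + 1) = t * c\<close>, so the quadratic term can cancel at most
    half of \<open>2 * t * c\<close>.\<close>
  define t where "t = c / (\<bar>e\<bar> + 1)"
  have "t\<^sup>2 * (\<bar>e\<bar> + 1) = t * c" by (simp add: t_def power2_eq_square)
  moreover have "t * c > 0"
  proof -
    have "c * c > 0" using c by (auto simp: zero_less_mult_iff)
    then show ?thesis by (simp add: t_def)
  qed
  moreover have "t\<^sup>2 * e \<ge> - (t\<^sup>2 * (\<bar>e\<bar> + 1))"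
    using mult_left_mono[of "- (\<bar>e\<bar> + 1)" e "t\<^sup>2"] abs_ge_minus_self[of e]
    by (simp only: mult_minus_right) (simp add: minus_le_iff)
  ultimately show False using assms[of t] by simp
qed

text \<open>The new eigenvector maximises the quadratic form on the unit sphere of the orthogonal
  complement, which is invariant under the symmetric matrix.\<close>

lemma extend_eigenfamily:
  assumes sym: "\<And>i j. i < m \<Longrightarrow> j < m \<Longrightarrow> a i j = a j i"
    and "j < m"
    and eig: "\<And>l i. l < j \<Longrightarrow> i < m \<Longrightarrow> apply_kernel m a (u l) i = e l * u l i"
  obtains g \<mu> where "dotp m g g = 1" "\<And>l. l < j \<Longrightarrow> dotp m (u l) g = 0"
    "\<And>i. i < m \<Longrightarrow> apply_kernel m a g i = \<mu> * g i"
proof -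
  define S where
    "S = {x. dotp m x x = 1 \<and> (\<forall>l<j. dotp m (u l) x = 0) \<and> (\<forall>i\<ge>m. x i = 0)}"
  let ?q = "\<lambda>x. dotp m x (apply_kernel m a x)"
  have "compact S" unfolding S_def by (rule compact_unit_sphere_orthogonal)
  moreover have "S \<noteq> {}" using exists_orthogonal[OF \<open>j < m\<close>, of u] by (auto simp: S_def)
  moreover have "continuous_on UNIV ?q"
    unfolding dotp_def apply_kernel_def by (intro continuous_intros) auto
  then have "continuous_on S ?q" by (rule continuous_on_subset) simp
  ultimately have "\<exists>g\<in>S. \<forall>y\<in>S. ?q y \<le> ?q g" by (rule continuous_attains_sup)
  then obtain g where g: "g \<in> S" "\<And>y. y \<in> S \<Longrightarrow> ?q y \<le> ?q g" by blast
  define \<mu> where "\<mu> = ?q g"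
  have gS: "dotp m g g = 1" "\<And>l. l < j \<Longrightarrow> dotp m (u l) g = 0" using g(1) by (auto simp: S_def)
  \<comment> \<open>Both sides are homogeneous of degree two, so maximality of \<open>g\<close> on
    the sphere extends to the whole orthogonal complement. The rescaled vector is cut off at
    \<open>m\<close> to lie in \<open>S\<close>.\<close>
  have bound: "?q x \<le> \<mu> * dotp m x x" if x: "\<And>l. l < j \<Longrightarrow> dotp m (u l) x = 0" for x
  proof (cases "dotp m x x = 0")
    case True
    have "?q x = dotp m (\<lambda>_. 0) (apply_kernel m a x)"
      by (rule dotp_cong) (use dotp_eq_0D[OF True] in auto)
    then show ?thesis using True by (simp add: dotp_def)
  next
    case False
    then have pos: "dotp m x x > 0" using dotp_nonneg[of m x] by linarith
    define c where "c = 1 / sqrt (dotp m x x)"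
    define y where "y i = (if i < m then c * x i else 0)" for i
    have c: "c * c * dotp m x x = 1" using pos by (simp add: c_def)
    have yx: "dotp m v y = c * dotp m v x" for v
      unfolding dotp_scale_right[symmetric] by (rule dotp_cong) (auto simp: y_def)
    have "dotp m y y = 1" using yx[of y] yx[of x] c dotp_commute[of m y x] by simp
    then have "y \<in> S" using x yx by (auto simp: S_def y_def)
    then have "?q y \<le> \<mu>" using g(2) by (simp add: \<mu>_def)
    moreover have "?q y = c * c * ?q x"
    proof -
      have "apply_kernel m a y = (\<lambda>i. c * apply_kernel m a x i)"
        unfolding apply_kernel_scale[symmetric] by (rule apply_kernel_cong) (simp add: y_def)
      then show ?thesis
        using yx[of "apply_kernel m a x"] by (simp add: dotp_scale_right dotp_commute)
    qed
    ultimately have "c * c * ?q x \<le> \<mu>" by simp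
    then have "c * c * ?q x * dotp m x x \<le> \<mu> * dotp m x x"
      using pos by (intro mult_right_mono) auto
    moreover have "c * c * ?q x * dotp m x x = (c * c * dotp m x x) * ?q x"
      by (simp only: mult_ac)
    ultimately show ?thesis using c by simp
  qed
  \<comment> \<open>The residual of the eigenvalue equation. It is orthogonal to the old family, so
    it is an admissible direction in which to vary \<open>g\<close>.\<close>
  define h where "h i = apply_kernel m a g i + (- \<mu>) * g i" for i
  have h_eq: "h = (\<lambda>i. apply_kernel m a g i + (- \<mu>) * g i)" by (simp add: h_def fun_eq_iff)
  have orth: "dotp m (u l) h = 0" if "l < j" for l
  proof -
    have "dotp m (u l) (apply_kernel m a g) = dotp m (apply_kernel m a (u l)) g"
      using dotp_apply_kernel[of m a "u l" g] sym by simp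
    also have "\<dots> = dotp m (\<lambda>i. e l * u l i) g"
      by (rule dotp_cong) (use eig that in auto)
    finally show ?thesis
      unfolding h_eq dotp_add_right dotp_scale_right using gS(2)[OF that] by (simp add: dotp_scale_left)
  qed
  \<comment> \<open>Expand the maximality inequality at \<open>g + t h\<close>. By symmetry the two
    cross terms agree, and the coefficient of \<open>2 * t\<close> is the squared norm of the
    residual.\<close>
  have "2 * t * dotp m h h + t\<^sup>2 * (?q h - \<mu> * dotp m h h) \<le> 0" for t
  proof -
    let ?y = "\<lambda>i. g i + t * h i"
    have "?q ?y \<le> \<mu> * dotp m ?y ?y"
      by (rule bound) (simp add: dotp_add_right dotp_scale_right gS orth)
    moreover have "?q ?y = ?q g + 2 * t * dotp m h (apply_kernel m a g) + t\<^sup>2 * ?q h"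
      using dotp_apply_kernel[of m a g h] sym
      by (simp add: apply_kernel_add apply_kernel_scale dotp_add_left dotp_add_right
          dotp_scale_left dotp_scale_right dotp_commute power2_eq_square algebra_simps)
    moreover have "dotp m ?y ?y = 1 + 2 * t * dotp m h g + t\<^sup>2 * dotp m h h"
      using gS by (simp add: dotp_add_left dotp_add_right
          dotp_scale_left dotp_scale_right dotp_commute power2_eq_square algebra_simps)
    moreover have "dotp m h h = dotp m h (apply_kernel m a g) - \<mu> * dotp m h g"
      by (subst (2) h_eq) (simp only: dotp_add_right dotp_scale_right)
    ultimately have le: "\<mu> + 2 * t * dotp m h (apply_kernel m a g) + t\<^sup>2 * ?q h
        \<le> \<mu> * (1 + 2 * t * dotp m h g + t\<^sup>2 * dotp m h h)"
      and hh: "dotp m h h = dotp m h (apply_kernel m a g) - \<mu> * dotp m h g"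
      by (simp_all add: \<mu>_def)
    have "2 * t * (dotp m h (apply_kernel m a g) - \<mu> * dotp m h g)
        + t\<^sup>2 * (?q h - \<mu> * dotp m h h) \<le> 0"
      using le by (simp add: algebra_simps)
    then show ?thesis by (simp only: hh[symmetric])
  qed
  then have "dotp m h h = 0" by (rule quadratic_nonpos_linear_zero)
  then have "apply_kernel m a g i = \<mu> * g i" if "i < m" for i
    using dotp_eq_0D that by (fastforce simp: h_def)
  with gS show thesis by (intro that)
qed

section \<open>Diagonalisation with a prescribed first eigenvector\<close>

text \<open>The extension step is iterated from \<open>v\<close>. Prescribing the first vector later
  allows the constant vector of a regular graph to sit at index 0.\<close>

lemma orthonormal_eigenbasis:
  assumes sym: "\<And>i j. i < m \<Longrightarrow> j < m \<Longrightarrow> a i j = a j i"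
    and v: "dotp m v v = 1" "\<And>i. i < m \<Longrightarrow> apply_kernel m a v i = d * v i"
  obtains u e where "u 0 = v" "e 0 = d"
    "\<And>l k. l < m \<Longrightarrow> k < m \<Longrightarrow> dotp m (u l) (u k) = (if l = k then 1 else 0)"
    "\<And>l i. l < m \<Longrightarrow> i < m \<Longrightarrow> apply_kernel m a (u l) i = e l * u l i"
proof -
  have "\<exists>u e. u 0 = v \<and> e 0 = d \<and>
      (\<forall>l<Suc j. \<forall>k<Suc j. dotp m (u l) (u k) = (if l = k then 1 else 0)) \<and>
      (\<forall>l<Suc j. \<forall>i<m. apply_kernel m a (u l) i = e l * u l i)" if "j < m" for j
    using that
  proof (induction j)
    case 0
    show ?case by (rule exI[of _ "\<lambda>_. v"], rule exI[of _ "\<lambda>_. d"]) (use v in auto)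
  next
    case (Suc j)
    then obtain u e where ue: "u 0 = v" "e 0 = d"
      "\<And>l k. l < Suc j \<Longrightarrow> k < Suc j \<Longrightarrow> dotp m (u l) (u k) = (if l = k then 1 else 0)"
      "\<And>l i. l < Suc j \<Longrightarrow> i < m \<Longrightarrow> apply_kernel m a (u l) i = e l * u l i"
      by (metis Suc_lessD)
    obtain g \<mu> where g: "dotp m g g = 1" "\<And>l. l < Suc j \<Longrightarrow> dotp m (u l) g = 0"
      "\<And>i. i < m \<Longrightarrow> apply_kernel m a g i = \<mu> * g i"
      by (rule extend_eigenfamily[OF sym Suc.prems ue(4)]) auto
    define u' e' where "u' = u(Suc j := g)" and "e' = e(Suc j := \<mu>)"
    have "dotp m (u' l) (u' k) = (if l = k then 1 else 0)"
      if "l < Suc (Suc j)" "k < Suc (Suc j)" for l k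
    proof -
      consider "l < Suc j" "k < Suc j" | "l = Suc j" "k < Suc j" | "l < Suc j" "k = Suc j"
        | "l = Suc j" "k = Suc j"
        using \<open>l < Suc (Suc j)\<close> \<open>k < Suc (Suc j)\<close> by linarith
      then show ?thesis
        by cases (use ue(3) g dotp_commute[of m g "u k"] in \<open>simp_all add: u'_def\<close>)
    qed
    moreover have "apply_kernel m a (u' l) i = e' l * u' l i" if "l < Suc (Suc j)" "i < m" for l i
      using that ue(4) g(3) by (cases "l = Suc j") (simp_all add: u'_def e'_def)
    moreover have "u' 0 = v" "e' 0 = d" using ue by (simp_all add: u'_def e'_def)
    ultimately show ?case by blast
  qed
  \<comment> \<open>A vector of norm 1 forces \<open>m > 0\<close>, so the induction reaches a full
    family of \<open>m\<close> vectors.\<close>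
  moreover obtain j where "m = Suc j" using v(1) by (cases m) (auto simp: dotp_def)
  ultimately show thesis using that by (metis lessI)
qed

text \<open>With the eigenvectors as columns of \<open>P\<close> and \<open>Q\<close> its transpose,
  the matrix is \<open>P * B * Q\<close> for a diagonal \<open>B\<close>, hence similar to
  \<open>B\<close>. The second claim is completeness of the basis, needed to expand vectors in
  it.\<close>

lemma char_poly_orthonormal_eigenbasis:
  assumes on: "\<And>l k. l < m \<Longrightarrow> k < m \<Longrightarrow> dotp m (u l) (u k) = (if l = k then 1 else 0)"
    and eig: "\<And>l i. l < m \<Longrightarrow> i < m \<Longrightarrow> apply_kernel m a (u l) i = e l * u l i"
  shows "char_poly (mat m m (\<lambda>(i, j). a i j)) = (\<Prod>x\<leftarrow>map e [0..<m]. [:- x, 1:])"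
    and "\<And>i k. i < m \<Longrightarrow> k < m \<Longrightarrow> (\<Sum>l<m. u l i * u l k) = (if i = k then 1 else 0)"
proof -
  define A where "A = mat m m (\<lambda>(i, j). a i j)"
  define P where "P = mat m m (\<lambda>(i, l). u l i)"
  define Q where "Q = mat m m (\<lambda>(l, i). u l i)"
  define B where "B = mat m m (\<lambda>(i, l). if i = l then e l else 0)"
  have carr: "A \<in> carrier_mat m m" "P \<in> carrier_mat m m" "Q \<in> carrier_mat m m" "B \<in> carrier_mat m m"
    by (simp_all add: A_def P_def Q_def B_def)
  have QP: "Q * P = 1\<^sub>m m"
    by (rule eq_matI) (use on in \<open>auto simp: Q_def P_def scalar_prod_def dotp_def atLeast0LessThan\<close>)
  \<comment> \<open>For square matrices a left inverse is a right inverse; this turns orthonormality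
    into completeness.\<close>
  then have PQ: "P * Q = 1\<^sub>m m"
    using mat_mult_left_right_inverse[OF carr(3,2)] by simp
  have "A * P = P * B"
    by (rule eq_matI)
      (use eig in \<open>auto simp: A_def P_def B_def scalar_prod_def apply_kernel_def atLeast0LessThan
        if_distrib if_distribR cong: if_cong\<close>)
  then have "P * B * Q = A * (P * Q)"
    using carr by (metis assoc_mult_mat)
  then have "A = P * B * Q" using PQ carr by simp
  then have "similar_mat A B"
    using carr PQ QP by (intro similar_matI[where n = m and P = P and Q = Q]) auto
  then have "char_poly A = char_poly B" by (rule char_poly_similar)
  also have "\<dots> = (\<Prod>x\<leftarrow>diag_mat B. [:- x, 1:])"
    using carr(4) by (rule char_poly_upper_triangular) (auto simp: B_def)
  also have "diag_mat B = map e [0..<m]" by (auto simp: diag_mat_def B_def)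
  finally show "char_poly (mat m m (\<lambda>(i, j). a i j)) = (\<Prod>x\<leftarrow>map e [0..<m]. [:- x, 1:])"
    by (simp add: A_def)
  show "(\<Sum>l<m. u l i * u l k) = (if i = k then 1 else 0)" if "i < m" "k < m" for i k
  proof -
    have "(\<Sum>l<m. u l i * u l k) = (P * Q) $$ (i, k)"
      using that by (simp add: P_def Q_def scalar_prod_def atLeast0LessThan)
    then show ?thesis using PQ that by simp
  qed
qed

section \<open>The quadratic form bounded by the second eigenvalue\<close>

lemma proots_prod_linear: "proots (\<Prod>x\<leftarrow>xs. [:- x, 1:]) = mset (xs :: real list)"
proof (induction xs)
  case (Cons x xs)
  have "(\<Prod>x\<leftarrow>xs. [:- x, 1:]) \<noteq> 0" by (auto simp: prod_list_zero_iff)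
  with Cons show ?case by (simp add: proots_mult del: mult_pCons_left)
qed simp

text \<open>Only one copy of the maximum \<open>d\<close> is set aside, so index 1 holds the maximum
  of \<open>xs\<close>, which is again \<open>d\<close> if \<open>d\<close> is a multiple
  eigenvalue.\<close>

lemma le_second_largest:
  fixes d x :: real
  assumes "\<And>y. y \<in> set xs \<Longrightarrow> y \<le> d" and "x \<in> set xs"
  shows "x \<le> rev (sorted_list_of_multiset (mset (d # xs))) ! 1"
proof -
  have "sorted_list_of_multiset (mset (d # xs)) = sort xs @ [d]"
    unfolding sorted_list_of_multiset_mset
    by (rule properties_for_sort) (use assms(1) in \<open>auto simp: sorted_append\<close>)
  moreover have ne: "sort xs \<noteq> []" using assms(2) by (metis empty_iff list.set(1) set_sort)
  ultimately have "rev (sorted_list_of_multiset (mset (d # xs))) ! 1 = last (sort xs)"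
    by (simp add: hd_rev[symmetric] hd_conv_nth)
  moreover have "x \<le> last (sort xs)"
  proof -
    obtain i where i: "i < length (sort xs)" "x = sort xs ! i"
      using assms(2) by (metis in_set_conv_nth set_sort)
    then show ?thesis using ne by (simp add: last_conv_nth sorted_nth_mono)
  qed
  ultimately show ?thesis by simp
qed

text \<open>Expand \<open>f\<close> in an eigenbasis starting with the constant vector. Since
  \<open>f\<close> sums to zero, its coefficient there vanishes, and by \<open>top\<close> the
  remaining eigenvalues are bounded by the entry at index 1.\<close>

lemma second_largest_eigenvalue_bound:
  assumes sym: "\<And>i j. i < m \<Longrightarrow> j < m \<Longrightarrow> a i j = a j i"
    and row: "\<And>i. i < m \<Longrightarrow> (\<Sum>j<m. a i j) = d"
    and top: "\<And>x. dotp m x (apply_kernel m a x) \<le> d * dotp m x x"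
    and f: "(\<Sum>i<m. f i) = 0"
  shows "dotp m f (apply_kernel m a f)
    \<le> second_largest_eigenvalue (mat m m (\<lambda>(i, j). a i j)) * dotp m f f"
proof (cases "m = 0")
  case False
  define v :: "nat \<Rightarrow> real" where "v = (\<lambda>_. 1 / sqrt m)"
  have v: "dotp m v v = 1" using False by (simp add: dotp_def v_def)
  have ev: "apply_kernel m a v i = d * v i" if "i < m" for i
    using row[OF that] by (simp add: apply_kernel_def v_def sum_divide_distrib[symmetric])
  obtain u e where ue: "u 0 = v" "e 0 = d"
    "\<And>l k. l < m \<Longrightarrow> k < m \<Longrightarrow> dotp m (u l) (u k) = (if l = k then 1 else 0)"
    "\<And>l i. l < m \<Longrightarrow> i < m \<Longrightarrow> apply_kernel m a (u l) i = e l * u l i"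
    using orthonormal_eigenbasis[where a = a, OF sym v ev] by blast
  note cp = char_poly_orthonormal_eigenbasis[of m u a e, OF ue(3,4)]
  have e_le: "e l \<le> d" if "l < m" for l
  proof -
    have "dotp m (u l) (apply_kernel m a (u l)) = e l * dotp m (u l) (u l)"
      unfolding dotp_scale_right[symmetric] by (rule dotp_cong) (use ue(4) that in auto)
    then show ?thesis using top[of "u l"] ue(3)[OF that that] by simp
  qed
  define lam where "lam = second_largest_eigenvalue (mat m m (\<lambda>(i, j). a i j))"
  have "map e [0..<m] = d # map e [1..<m]" using False ue(2) by (simp add: upt_rec)
  then have lam_eq: "lam = rev (sorted_list_of_multiset (mset (d # map e [1..<m]))) ! 1"
    using cp(1) by (simp only: lam_def second_largest_eigenvalue_def proots_prod_linear)
  \<comment> \<open>For \<open>m = 1\<close> the entry at index 1 is unspecified, but then there is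
    no such \<open>l\<close>.\<close>
  have e_lam: "e l \<le> lam" if "l < m" "l \<noteq> 0" for l
    unfolding lam_eq by (rule le_second_largest) (use e_le that in auto)
  define c where "c l = dotp m (u l) f" for l
  have f_eq: "f i = (\<Sum>l<m. c l * u l i)" if "i < m" for i
  proof -
    have "(\<Sum>l<m. c l * u l i) = (\<Sum>l<m. \<Sum>k<m. u l i * u l k * f k)"
      by (simp add: c_def dotp_def sum_distrib_left sum_distrib_right mult_ac)
    also have "\<dots> = (\<Sum>k<m. (\<Sum>l<m. u l i * u l k) * f k)"
      by (subst sum.swap) (simp add: sum_distrib_right)
    also have "\<dots> = (\<Sum>k<m. if i = k then f k else 0)"
      by (intro sum.cong refl) (use cp(2) that in auto)
    finally show ?thesis using that by simp
  qed
  have exp: "dotp m x f = (\<Sum>l<m. c l * dotp m x (u l))" for x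
  proof -
    have "dotp m x f = dotp m x (\<lambda>i. \<Sum>l<m. c l * u l i)"
      by (rule dotp_cong) (use f_eq in auto)
    then show ?thesis by (simp add: dotp_sum_right dotp_scale_right)
  qed
  have ff: "dotp m f f = (\<Sum>l<m. c l * c l)"
    using exp[of f] by (simp add: c_def dotp_commute)
  have "dotp m (apply_kernel m a f) (u l) = e l * c l" if "l < m" for l
  proof -
    have "dotp m (apply_kernel m a f) (u l) = dotp m f (apply_kernel m a (u l))"
      using dotp_apply_kernel[of m a f "u l"] sym by simp
    also have "\<dots> = dotp m f (\<lambda>i. e l * u l i)"
      by (rule dotp_cong) (use ue(4) that in auto)
    finally show ?thesis by (simp add: dotp_scale_right c_def dotp_commute)
  qed
  then have "dotp m f (apply_kernel m a f) = (\<Sum>l<m. e l * (c l * c l))"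
    using exp[of "apply_kernel m a f"] by (simp add: dotp_commute mult_ac)
  also have "\<dots> \<le> (\<Sum>l<m. lam * (c l * c l))"
  proof (rule sum_mono)
    fix l assume l: "l \<in> {..<m}"
    show "e l * (c l * c l) \<le> lam * (c l * c l)"
    proof (cases "l = 0")
      case True
      \<comment> \<open>The coefficient at index 0 is a multiple of the sum of
        \<open>f\<close>.\<close>
      then have "c l = 0"
        using f ue(1) by (simp add: c_def dotp_def v_def sum_divide_distrib[symmetric])
      then show ?thesis by simp
    next
      case False
      then show ?thesis using e_lam l by (intro mult_right_mono) auto
    qed
  qed
  finally show ?thesis by (simp add: ff lam_def sum_distrib_left)
qed (simp add: dotp_def)

section \<open>The embedded graph and its cuts\<close>

text \<open>With \<open>i\<close> the offset of \<open>j\<close> from \<open>m div 2\<close> and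
  \<open>r\<close> the parity of \<open>m\<close>, the right side minus the left is
  \<open>i * (i - r)\<close>. No integer lies strictly between 0 and \<open>r\<close>, so this is
  nonnegative.\<close>

lemma balanced_product_bound:
  fixes j m :: nat
  shows "real j * (real m - real j) \<le> real (m div 2) * (real m - real (m div 2))"
proof -
  define i where "i = int j - int (m div 2)"
  define r where "r = int (m mod 2)"
  have r: "r = 0 \<or> r = 1" by (auto simp: r_def)
  have m: "int m = 2 * int (m div 2) + r"
    unfolding r_def of_nat_mod of_nat_div by simp
  have "i * (i - r) \<ge> 0"
    using r by (cases "i \<le> 0") (auto simp: mult_nonneg_nonneg mult_nonpos_nonpos)
  then have "int j * (int m - int j) \<le> int (m div 2) * (int m - int (m div 2))"
    unfolding m by (simp add: i_def algebra_simps)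
  then have "real_of_int (int j * (int m - int j)) \<le> real_of_int (int (m div 2) * (int m - int (m div 2)))"
    by (simp only: of_int_le_iff)
  then show ?thesis by simp
qed

text \<open>Distinct naturals differ by at least 1, and \<open>(p - q)\<^sup>2\<close> is at most
  \<open>2 * (p\<^sup>2 + q\<^sup>2)\<close> with \<open>p\<close>, \<open>q\<close> the deviations
  from \<open>c\<close>; the difference is \<open>(p + q)\<^sup>2\<close>.\<close>

lemma half_le_square_deviation:
  fixes x :: "'a \<Rightarrow> nat" and c :: real
  assumes "finite S" "s \<in> S" "t \<in> S" "x s \<noteq> x t"
  shows "1 / 2 \<le> (\<Sum>i\<in>S. (real (x i) - c)\<^sup>2)"
proof -
  have "\<bar>real (x s) - real (x t)\<bar> \<ge> 1" using assms(4) by linarith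
  then have "1 \<le> (real (x s) - real (x t))\<^sup>2" by (metis abs_le_square_iff abs_one one_power2)
  also have "\<dots> \<le> 2 * ((real (x s) - c)\<^sup>2 + (real (x t) - c)\<^sup>2)"
    using sum_squares_ge_zero zero_le_power2[of "(real (x s) - c) + (real (x t) - c)"]
    by (simp add: power2_eq_square algebra_simps)
  also have "(real (x s) - c)\<^sup>2 + (real (x t) - c)\<^sup>2 = (\<Sum>i\<in>{s, t}. (real (x i) - c)\<^sup>2)"
    using assms(4) by (subst sum.insert) auto
  also have "\<dots> \<le> (\<Sum>i\<in>S. (real (x i) - c)\<^sup>2)"
    using assms by (intro sum_mono2) auto
  finally show ?thesis by simp
qed

section \<open>Ridges, top faces and the adjacency form\<close>

locale codegree_regular_complex =
  fixes X :: "'v set set" and n D :: nat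
  assumes n_pos: "n > 0"
    and complex: "finite_simplicial_complex X"
    and codegree: "\<And>w. w \<in> faces X (n - 1) \<Longrightarrow> card {f \<in> faces X n. w \<subseteq> f} = D"
begin

abbreviation "top_faces \<equiv> faces X n"
abbreviation "ridges \<equiv> faces X (n - 1)"

declare One_nat_def [simp del]

definition facets :: "'v set \<Rightarrow> 'v set set" where
  "facets f = {w \<in> ridges. w \<subseteq> f}"

definition adj :: "'v set \<Rightarrow> 'v set \<Rightarrow> real" where
  "adj s t = (if {s, t} \<in> embedded_edges X n then 1 else 0)"

lemma finite_face: "s \<in> X \<Longrightarrow> finite s"
  and face_nonempty: "s \<in> X \<Longrightarrow> s \<noteq> {}"
  and subface: "s \<in> X \<Longrightarrow> t \<subseteq> s \<Longrightarrow> t \<noteq> {} \<Longrightarrow> t \<in> X"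
  and finite_X: "finite X"
  using complex unfolding finite_simplicial_complex_def by blast+

lemma finite_faces [simp]: "finite (faces X d)"
  using finite_X by (simp add: faces_def)

text \<open>Faces are nonempty, so the truncated subtraction in \<open>face_dim\<close> does not
  merge cardinalities 0 and 1.\<close>

lemma faces_iff: "s \<in> faces X d \<longleftrightarrow> s \<in> X \<and> card s = d + 1"
proof -
  have "card s > 0" if "s \<in> X" using that finite_face face_nonempty card_gt_0_iff by blast
  then show ?thesis by (auto simp: faces_def face_dim_def)
qed

lemma facets_eq: assumes "f \<in> top_faces" shows "facets f = (\<lambda>v. f - {v}) ` f"
proof -
  have f: "f \<in> X" "card f = n + 1" "finite f" using assms finite_face by (auto simp: faces_iff)
  show ?thesis
  proof (intro equalityI subsetI)
    fix w assume "w \<in> facets f"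
    then have w: "w \<in> X" "card w = n" "w \<subseteq> f" using n_pos by (auto simp: facets_def faces_iff)
    then have "card (f - w) = 1" using f by (simp add: card_Diff_subset finite_face)
    then obtain v where "f - w = {v}" by (rule card_1_singletonE)
    then have "v \<in> f" "w = f - {v}" using w(3) by auto
    then show "w \<in> (\<lambda>v. f - {v}) ` f" by blast
  next
    fix w assume "w \<in> (\<lambda>v. f - {v}) ` f"
    then obtain v where v: "v \<in> f" "w = f - {v}" by blast
    then have "card w = n" using f by simp
    \<comment> \<open>The empty set is not a face, so \<open>n > 0\<close> is what makes
      \<open>f - {v}\<close> a ridge.\<close>
    then have "w \<noteq> {}" using n_pos by auto
    then show "w \<in> facets f"
      using v f n_pos subface[OF f(1), of w] \<open>card w = n\<close> by (auto simp: facets_def faces_iff)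
  qed
qed

lemma inj_on_facets: "inj_on (\<lambda>v. f - {v}) f"
  by (auto simp: inj_on_def)

lemma sum_facets:
  assumes "f \<in> top_faces" shows "sum g (facets f) = (\<Sum>v\<in>f. g (f - {v}))"
  unfolding facets_eq[OF assms] by (subst sum.reindex[OF inj_on_facets]) simp

lemma card_facets: "f \<in> top_faces \<Longrightarrow> card (facets f) = n + 1"
  by (simp add: facets_eq card_image[OF inj_on_facets] faces_iff)

lemma finite_facets [simp]: "finite (facets f)"
  by (simp add: facets_def)

text \<open>Two distinct ridges span at most one top face, namely their union; hence sums over
  adjacent pairs of ridges split as sums over the top faces.\<close>

lemma adj_eq_sum:
  assumes "s \<in> ridges" "t \<in> ridges"
  shows "adj s t = (\<Sum>f\<in>top_faces. if s \<subseteq> f \<and> t \<subseteq> f \<and> s \<noteq> t then 1 else 0)"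
proof -
  have edge: "{s, t} \<in> embedded_edges X n \<longleftrightarrow> s \<noteq> t \<and> (\<exists>f\<in>top_faces. s \<subseteq> f \<and> t \<subseteq> f)"
    using assms unfolding embedded_edges_def mem_Collect_eq doubleton_eq_iff by blast
  show ?thesis
  proof (cases "{s, t} \<in> embedded_edges X n")
    case True
    then obtain f where f: "s \<noteq> t" "f \<in> top_faces" "s \<subseteq> f" "t \<subseteq> f" using edge by blast
    \<comment> \<open>Distinct sets of size \<open>n\<close> have a union of size at least
      \<open>n + 1\<close>, which therefore exhausts any top face containing both.\<close>
    have un: "g = s \<union> t" if "g \<in> top_faces" "s \<subseteq> g" "t \<subseteq> g" for g
    proof -
      have fin: "finite g" "card g = n + 1" using that(1) finite_face by (auto simp: faces_iff)
      have st: "card s = n" "card t = n" "finite s" "finite t"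
        using assms n_pos finite_face by (auto simp: faces_iff)
      have "\<not> t \<subseteq> s" using st f(1) card_subset_eq by metis
      then have "card (s \<union> t) > card s" using st by (intro psubset_card_mono) auto
      then have "card g \<le> card (s \<union> t)" using fin(2) st(1) by simp
      then have "s \<union> t = g" using that fin(1) by (intro card_seteq) auto
      then show ?thesis by simp
    qed
    have iff: "(s \<subseteq> g \<and> t \<subseteq> g \<and> s \<noteq> t) \<longleftrightarrow> g = f" if "g \<in> top_faces" for g
      using f un[OF f(2-4)] un[OF that] by blast
    have "(\<Sum>g\<in>top_faces. if s \<subseteq> g \<and> t \<subseteq> g \<and> s \<noteq> t then 1 else 0)
        = (\<Sum>g\<in>top_faces. if g = f then 1 else (0::real))"
      by (intro sum.cong refl) (simp only: iff)
    then show ?thesis using True f(2) by (simp add: adj_def)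
  next
    case False
    then have "adj s t = 0" by (simp add: adj_def)
    moreover have "(s \<subseteq> f \<and> t \<subseteq> f \<and> s \<noteq> t) = False" if "f \<in> top_faces" for f
      using edge False that by blast
    then have "(\<Sum>f\<in>top_faces. if s \<subseteq> f \<and> t \<subseteq> f \<and> s \<noteq> t then 1 else 0) = (\<Sum>f\<in>top_faces. 0 :: real)"
      by (intro sum.cong refl) (simp only: if_False)
    ultimately show ?thesis by simp
  qed
qed

lemma sum_adj:
  "(\<Sum>s\<in>ridges. \<Sum>t\<in>ridges. adj s t * h s t)
    = (\<Sum>f\<in>top_faces. \<Sum>s\<in>facets f. \<Sum>t\<in>facets f. if s \<noteq> t then h s t else 0)"
proof -
  \<comment> \<open>The indicator is split into nested conditions so that, after the sums are
    swapped, each condition restricts one sum to the facets of \<open>f\<close>.\<close>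
  have "(\<Sum>s\<in>ridges. \<Sum>t\<in>ridges. adj s t * h s t)
      = (\<Sum>s\<in>ridges. \<Sum>t\<in>ridges. \<Sum>f\<in>top_faces.
          if s \<subseteq> f then if t \<subseteq> f then if s \<noteq> t then h s t else 0 else 0 else 0)"
  proof (intro sum.cong refl)
    fix s t assume st: "s \<in> ridges" "t \<in> ridges"
    show "adj s t * h s t
        = (\<Sum>f\<in>top_faces. if s \<subseteq> f then if t \<subseteq> f then if s \<noteq> t then h s t else 0 else 0 else 0)"
      unfolding adj_eq_sum[OF st] sum_distrib_right by (rule sum.cong) simp_all
  qed
  also have "\<dots> = (\<Sum>s\<in>ridges. \<Sum>f\<in>top_faces. \<Sum>t\<in>ridges.
          if s \<subseteq> f then if t \<subseteq> f then if s \<noteq> t then h s t else 0 else 0 else 0)"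
    by (intro sum.cong refl sum.swap)
  also have "\<dots> = (\<Sum>f\<in>top_faces. \<Sum>s\<in>ridges. \<Sum>t\<in>ridges.
          if s \<subseteq> f then if t \<subseteq> f then if s \<noteq> t then h s t else 0 else 0 else 0)"
    by (rule sum.swap)
  also have "\<dots> = (\<Sum>f\<in>top_faces. \<Sum>s\<in>ridges.
          if s \<subseteq> f then \<Sum>t\<in>ridges. if t \<subseteq> f then if s \<noteq> t then h s t else 0 else 0 else 0)"
    by (intro sum.cong refl) auto
  also have "\<dots> = (\<Sum>f\<in>top_faces. \<Sum>s\<in>facets f. \<Sum>t\<in>facets f. if s \<noteq> t then h s t else 0)"
    by (simp add: facets_def sum.inter_filter)
  finally show ?thesis .
qed

text \<open>The ridge \<open>s\<close> lies in \<open>D\<close> top faces, each with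
  \<open>n\<close> further facets, and no neighbour is counted twice.\<close>

lemma row_sum_adj:
  assumes "s \<in> ridges" shows "(\<Sum>t\<in>ridges. adj s t) = real n * real D"
proof -
  have "(\<Sum>t\<in>ridges. adj s t)
      = (\<Sum>t\<in>ridges. \<Sum>f\<in>top_faces. if s \<subseteq> f then if t \<subseteq> f then if s \<noteq> t then 1 else 0 else 0 else 0)"
  proof (intro sum.cong refl)
    fix t assume t: "t \<in> ridges"
    show "adj s t
        = (\<Sum>f\<in>top_faces. if s \<subseteq> f then if t \<subseteq> f then if s \<noteq> t then 1 else 0 else 0 else 0)"
      unfolding adj_eq_sum[OF assms t] by (rule sum.cong) simp_all
  qed
  also have "\<dots> = (\<Sum>f\<in>top_faces. \<Sum>t\<in>ridges. if s \<subseteq> f then if t \<subseteq> f then if s \<noteq> t then 1 else 0 else 0 else 0)"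
    by (rule sum.swap)
  also have "\<dots> = (\<Sum>f\<in>top_faces. if s \<subseteq> f then \<Sum>t\<in>ridges. if t \<subseteq> f then if s \<noteq> t then 1 else 0 else 0 else 0)"
    by (intro sum.cong refl) auto
  also have "\<dots> = (\<Sum>f | f \<in> top_faces \<and> s \<subseteq> f. \<Sum>t\<in>facets f. if s \<noteq> t then 1 else 0)"
    by (simp add: facets_def sum.inter_filter)
  also have "\<dots> = (\<Sum>f | f \<in> top_faces \<and> s \<subseteq> f. real n)"
  proof (intro sum.cong refl)
    fix f assume "f \<in> {f \<in> top_faces. s \<subseteq> f}"
    then have f: "f \<in> top_faces" "s \<in> facets f" using assms by (auto simp: facets_def)
    have "(\<Sum>t\<in>facets f. if s \<noteq> t then 1 else (0::real)) = (\<Sum>t\<in>facets f - {s}. 1)"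
      by (rule sum.mono_neutral_cong_right) auto
    then show "(\<Sum>t\<in>facets f. if s \<noteq> t then 1 else 0) = real n"
      using f by (simp add: card_facets)
  qed
  finally show ?thesis using codegree[OF assms] by simp
qed

lemma adj_commute: "adj s t = adj t s"
  by (simp add: adj_def insert_commute)

text \<open>This is the quadratic form of the graph Laplacian, the degree \<open>n * D\<close> minus
  adjacency. The factor 2 arises because ordered pairs count every edge twice.\<close>

lemma dirichlet_form:
  "(\<Sum>s\<in>ridges. \<Sum>t\<in>ridges. adj s t * (g s - g t)\<^sup>2)
    = 2 * (real n * real D * (\<Sum>s\<in>ridges. (g s)\<^sup>2) - (\<Sum>s\<in>ridges. g s * (\<Sum>t\<in>ridges. adj s t * g t)))"
proof -
  have "(\<Sum>s\<in>ridges. \<Sum>t\<in>ridges. adj s t * (g s - g t)\<^sup>2)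
    = (\<Sum>s\<in>ridges. \<Sum>t\<in>ridges. adj s t * (g s)\<^sup>2) + (\<Sum>s\<in>ridges. \<Sum>t\<in>ridges. adj s t * (g t)\<^sup>2)
      - 2 * (\<Sum>s\<in>ridges. \<Sum>t\<in>ridges. adj s t * (g s * g t))"
    by (simp add: power2_diff algebra_simps sum.distrib sum_subtractf sum_distrib_left)
  moreover have "(\<Sum>s\<in>ridges. \<Sum>t\<in>ridges. adj s t * (g s)\<^sup>2) = real n * real D * (\<Sum>s\<in>ridges. (g s)\<^sup>2)"
    by (simp add: sum_distrib_right[symmetric] row_sum_adj sum_distrib_left)
  moreover have "(\<Sum>s\<in>ridges. \<Sum>t\<in>ridges. adj s t * (g t)\<^sup>2)
      = (\<Sum>s\<in>ridges. \<Sum>t\<in>ridges. adj s t * (g s)\<^sup>2)"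
    by (subst sum.swap) (simp add: adj_commute)
  moreover have "(\<Sum>s\<in>ridges. \<Sum>t\<in>ridges. adj s t * (g s * g t))
      = (\<Sum>s\<in>ridges. g s * (\<Sum>t\<in>ridges. adj s t * g t))"
    by (simp add: sum_distrib_left algebra_simps)
  ultimately show ?thesis by simp
qed

text \<open>Deleting \<open>v\<close> from \<open>f\<close> lowers the trace on \<open>A\<close> by
  one exactly when \<open>v\<close> is in \<open>A\<close>. Hence an ordered pair of facets
  contributes 1 if exactly one of the two deleted vertices lies in \<open>A\<close>, and 0
  otherwise.\<close>

lemma sum_facets_cut:
  assumes "f \<in> top_faces"
  shows "(\<Sum>s\<in>facets f. \<Sum>t\<in>facets f. if s \<noteq> t then (real (card (s \<inter> A)) - real (card (t \<inter> A)))\<^sup>2 else 0)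
    = 2 * (real (card (f \<inter> A)) * (real n + 1 - real (card (f \<inter> A))))"
proof -
  have fin: "finite f" "card f = n + 1" using assms finite_face by (auto simp: faces_iff)
  let ?j = "card (f \<inter> A)"
  have cut: "real (card ((f - {v}) \<inter> A)) = real ?j - of_bool (v \<in> A)" if "v \<in> f" for v
  proof (cases "v \<in> A")
    case True
    then have "card (f \<inter> A) > 0" using that fin by (auto simp: card_gt_0_iff)
    moreover have "(f - {v}) \<inter> A = f \<inter> A - {v}" by auto
    ultimately show ?thesis using True that fin by simp
  next
    case False
    then have "(f - {v}) \<inter> A = f \<inter> A" by auto
    then show ?thesis using False by simp
  qed
  have split: "(\<Sum>u\<in>f. (of_bool (u \<in> A) :: real)) = real ?j"
    "(\<Sum>u\<in>f. (1 - of_bool (u \<in> A) :: real)) = real n + 1 - real ?j"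
    using fin by (simp_all add: sum_subtractf sum.inter_filter[symmetric] of_bool_def Int_def)
  have "(\<Sum>s\<in>facets f. \<Sum>t\<in>facets f. if s \<noteq> t then (real (card (s \<inter> A)) - real (card (t \<inter> A)))\<^sup>2 else 0)
     = (\<Sum>s\<in>facets f. \<Sum>t\<in>facets f. (real (card (s \<inter> A)) - real (card (t \<inter> A)))\<^sup>2)"
    by (intro sum.cong refl) auto
  also have "\<dots> = (\<Sum>v\<in>f. \<Sum>u\<in>f. (real (card ((f - {v}) \<inter> A)) - real (card ((f - {u}) \<inter> A)))\<^sup>2)"
    by (simp add: sum_facets assms)
  \<comment> \<open>The squared difference of two indicators is their exclusive or, written as
    products so that the double sum factorises.\<close>
  also have "\<dots> = (\<Sum>v\<in>f. \<Sum>u\<in>f. of_bool (v \<in> A) * (1 - of_bool (u \<in> A)) + of_bool (u \<in> A) * (1 - of_bool (v \<in> A)))"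
    by (intro sum.cong refl) (simp add: cut of_bool_def)
  also have "\<dots> = (\<Sum>v\<in>f. of_bool (v \<in> A) * (real n + 1 - real ?j) + real ?j * (1 - of_bool (v \<in> A)))"
    by (simp only: sum.distrib sum_distrib_left[symmetric] sum_distrib_right[symmetric] split)
  also have "\<dots> = real ?j * (real n + 1 - real ?j) + real ?j * (real n + 1 - real ?j)"
    by (simp only: sum.distrib sum_distrib_left[symmetric] sum_distrib_right[symmetric] split)
  finally show ?thesis by simp
qed

lemma cut_dirichlet_bound:
  assumes "V = vertices X"
  shows "(\<Sum>s\<in>ridges. \<Sum>t\<in>ridges. adj s t * (real (card (s \<inter> A)) - real (card (t \<inter> A)))\<^sup>2)
    \<le> 2 * real (card (crossing_faces X n A (V - A))) * (real ((n + 1) div 2) * (real n + 1 - real ((n + 1) div 2)))"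
    (is "?L \<le> 2 * _ * ?K")
proof -
  have "?L = (\<Sum>f\<in>top_faces. 2 * (real (card (f \<inter> A)) * (real n + 1 - real (card (f \<inter> A)))))"
    by (simp add: sum_adj sum_facets_cut)
  also have "\<dots> \<le> (\<Sum>f\<in>top_faces. if f \<inter> A \<noteq> {} \<and> f \<inter> (V - A) \<noteq> {} then 2 * ?K else 0)"
  proof (rule sum_mono)
    fix f assume f: "f \<in> top_faces"
    then have fV: "f \<subseteq> V" "card f = n + 1" using assms by (auto simp: vertices_def faces_iff)
    \<comment> \<open>For a face inside \<open>A\<close> the factor
      \<open>n + 1 - card (f \<inter> A)\<close> is zero; for a face disjoint from \<open>A\<close>
      the other factor is.\<close>
    have "f \<inter> A = f" if "f \<inter> (V - A) = {}" using that fV by auto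
    then show "2 * (real (card (f \<inter> A)) * (real n + 1 - real (card (f \<inter> A))))
        \<le> (if f \<inter> A \<noteq> {} \<and> f \<inter> (V - A) \<noteq> {} then 2 * ?K else 0)"
      using balanced_product_bound[of "card (f \<inter> A)" "n + 1"] fV(2) by (auto simp: add_ac)
  qed
  also have "\<dots> = 2 * real (card (crossing_faces X n A (V - A))) * ?K"
    by (simp add: crossing_faces_def sum.inter_filter[symmetric])
  finally show ?thesis .
qed

section \<open>Vertex degrees, purity and connectedness\<close>

lemma finite_vertices: "finite (vertices X)"
  using finite_X finite_face by (auto simp: vertices_def)

text \<open>Double counting of incidences: every ridge has \<open>n\<close> vertices.\<close>

lemma sum_face_degree: "(\<Sum>v\<in>vertices X. face_degree X n v) = n * card ridges"
proof -
  have "(\<Sum>v\<in>vertices X. face_degree X n v) = (\<Sum>v\<in>vertices X. \<Sum>w\<in>ridges. if v \<in> w then 1 else 0)"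
    by (simp add: face_degree_def sum.inter_filter[symmetric])
  also have "\<dots> = (\<Sum>w\<in>ridges. \<Sum>v\<in>vertices X. if v \<in> w then 1 else 0)" by (rule sum.swap)
  also have "\<dots> = (\<Sum>w\<in>ridges. n)"
  proof (intro sum.cong refl)
    fix w assume w: "w \<in> ridges"
    then have "{v \<in> vertices X. v \<in> w} = w" by (auto simp: vertices_def faces_iff)
    then show "(\<Sum>v\<in>vertices X. if v \<in> w then 1 else 0) = n"
      using w n_pos finite_vertices by (simp add: sum.inter_filter[symmetric] faces_iff)
  qed
  finally show ?thesis by simp
qed

lemma min_face_degree_bound: "min_face_degree X n * card (vertices X) \<le> n * card ridges"
proof -
  have "(\<Sum>v\<in>vertices X. min_face_degree X n) \<le> (\<Sum>v\<in>vertices X. face_degree X n v)"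
    unfolding min_face_degree_def using finite_vertices by (intro sum_mono Min_le) auto
  then show ?thesis by (simp add: sum_face_degree mult.commute)
qed

text \<open>A face of dimension \<open>n\<close> extends to a maximal face, still of dimension
  \<open>n\<close>. By purity all maximal faces then have dimension \<open>n\<close>, and every face
  lies in one of them.\<close>

lemma face_subset_top_face:
  assumes "pure_complex X" "has_dimension X n" "s \<in> X"
  obtains f where "f \<in> top_faces" "s \<subseteq> f"
proof -
  have ext: "\<exists>f\<in>maximal_faces X. s \<subseteq> f" if "s \<in> X" for s
    using finite_has_maximal2[OF finite_X that] by (auto simp: maximal_faces_def)
  have ne: "X \<noteq> {}" and max: "Max (face_dim ` X) = n"
    using assms(2) by (auto simp: has_dimension_def)
  have "n \<in> face_dim ` X" unfolding max[symmetric] using ne finite_X by (intro Max_in) auto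
  then obtain g where g: "g \<in> X" "face_dim g = n" by blast
  obtain h where h: "h \<in> maximal_faces X" "g \<subseteq> h" using ext g(1) by blast
  have hX: "h \<in> X" using h(1) by (simp add: maximal_faces_def)
  have "face_dim g \<le> face_dim h"
    unfolding face_dim_def by (intro diff_le_mono card_mono h(2) finite_face hX)
  moreover have "face_dim h \<le> n" using hX finite_X max by (metis Max_ge finite_imageI imageI)
  ultimately have "face_dim h = n" using g(2) by simp
  moreover obtain f where f: "f \<in> maximal_faces X" "s \<subseteq> f" using ext assms(3) by blast
  ultimately have "face_dim f = n" using assms(1) h(1) unfolding pure_complex_def by metis
  then show thesis using f that by (auto simp: maximal_faces_def faces_def)
qed

lemma crossing_edge:
  assumes "connected_complex X" "A \<subseteq> vertices X" "A \<noteq> {}" "A \<noteq> vertices X"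
  obtains x y where "x \<in> A" "y \<notin> A" "{x, y} \<in> X"
proof -
  obtain a b where ab: "a \<in> A" "b \<in> vertices X" "b \<notin> A" using assms by blast
  have "(a, b) \<in> {(x, y). {x, y} \<in> X}\<^sup>*"
    using assms ab by (auto simp: connected_complex_def)
  \<comment> \<open>Invariant along the path: the current vertex is in \<open>A\<close>, or some
    earlier step has left \<open>A\<close>.\<close>
  then have "b \<in> A \<or> (\<exists>x y. x \<in> A \<and> y \<notin> A \<and> {x, y} \<in> X)"
    by (induction rule: rtrancl_induct) (use ab(1) in auto)
  then show thesis using ab that by blast
qed

text \<open>Extend an edge \<open>{x, y}\<close> crossing the cut to a top face and delete either
  endpoint: only deleting \<open>x\<close>, the endpoint in \<open>A\<close>, changes the
  trace.\<close>

lemma ridges_with_distinct_traces: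
  assumes "connected_complex X" "pure_complex X" "has_dimension X n"
    "A \<subseteq> vertices X" "A \<noteq> {}" "A \<noteq> vertices X"
  obtains s t where "s \<in> ridges" "t \<in> ridges" "card (s \<inter> A) \<noteq> card (t \<inter> A)"
proof -
  obtain x y where xy: "x \<in> A" "y \<notin> A" "{x, y} \<in> X"
    using crossing_edge assms(1,4-6) by metis
  obtain f where f: "f \<in> top_faces" "{x, y} \<subseteq> f"
    using face_subset_top_face assms(2,3) xy(3) by metis
  have "finite f" using f(1) finite_face by (auto simp: faces_iff)
  have "f - {x} \<in> facets f" "f - {y} \<in> facets f" using facets_eq f by auto
  moreover have "card ((f - {x}) \<inter> A) < card ((f - {y}) \<inter> A)"
    using xy f(2) \<open>finite f\<close> by (intro psubset_card_mono) auto
  ultimately show thesis using that unfolding facets_def by (metis (mono_tags, lifting) mem_Collect_eq nat_neq_iff)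
qed

section \<open>The spectral gap and the bound for each cut\<close>

text \<open>The enumeration \<open>ws\<close> transports the matrix bound to functions on ridges.
  Nonnegativity of the Dirichlet form shows that the degree is the largest eigenvalue.\<close>

lemma spectral_gap:
  fixes g :: "'v set \<Rightarrow> real"
  assumes ws: "distinct ws" "set ws = ridges" and g: "(\<Sum>s\<in>ridges. g s) = 0"
  shows "2 * (real n * real D - second_largest_eigenvalue (adjacency_matrix ws (embedded_edges X n)))
      * (\<Sum>s\<in>ridges. (g s)\<^sup>2) \<le> (\<Sum>s\<in>ridges. \<Sum>t\<in>ridges. adj s t * (g s - g t)\<^sup>2)"
proof -
  define m where "m = length ws"
  define a where "a i j = adj (ws ! i) (ws ! j)" for i j
  have bij: "bij_betw ((!) ws) {..<m} ridges"
    using ws by (intro bij_betw_nth) (simp_all add: m_def)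
  have sum_ws: "(\<Sum>i<m. h (ws ! i)) = (\<Sum>s\<in>ridges. h s)" for h :: "'v set \<Rightarrow> real"
    using sum.reindex_bij_betw[OF bij] .
  have form: "dotp m (\<lambda>i. h (ws ! i)) (apply_kernel m a (\<lambda>i. h (ws ! i)))
      = (\<Sum>s\<in>ridges. h s * (\<Sum>t\<in>ridges. adj s t * h t))"
    and norm: "dotp m (\<lambda>i. h (ws ! i)) (\<lambda>i. h (ws ! i)) = (\<Sum>s\<in>ridges. (h s)\<^sup>2)"
    for h :: "'v set \<Rightarrow> real"
    by (simp_all only: dotp_def apply_kernel_def a_def sum_ws[symmetric] power2_eq_square)
  have top: "dotp m x (apply_kernel m a x) \<le> real n * real D * dotp m x x" for x
  proof -
    \<comment> \<open>Pulls an arbitrary vector \<open>x\<close> back along \<open>ws\<close> to a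
      function on ridges, to which \<open>dirichlet_form\<close> applies.\<close>
    define h where "h = x \<circ> inv_into {..<m} ((!) ws)"
    have h: "h (ws ! i) = x i" if "i < m" for i
      using bij_betw_inv_into_left[OF bij] that by (simp add: h_def)
    have "apply_kernel m a x = apply_kernel m a (\<lambda>i. h (ws ! i))"
      by (rule apply_kernel_cong) (simp add: h)
    then have "dotp m x (apply_kernel m a x) = (\<Sum>s\<in>ridges. h s * (\<Sum>t\<in>ridges. adj s t * h t))"
      unfolding form[symmetric] by (intro dotp_cong) (simp_all add: h)
    moreover have "dotp m x x = (\<Sum>s\<in>ridges. (h s)\<^sup>2)"
      unfolding norm[symmetric] by (intro dotp_cong) (simp_all add: h)
    moreover have "0 \<le> (\<Sum>s\<in>ridges. \<Sum>t\<in>ridges. adj s t * (h s - h t)\<^sup>2)"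
      by (intro sum_nonneg mult_nonneg_nonneg) (simp_all add: adj_def)
    ultimately show ?thesis using dirichlet_form[of h] by simp
  qed
  have "adjacency_matrix ws (embedded_edges X n) = mat m m (\<lambda>(i, j). a i j)"
    by (rule eq_matI) (simp_all add: adjacency_matrix_def m_def a_def adj_def)
  moreover have "dotp m (\<lambda>i. g (ws ! i)) (apply_kernel m a (\<lambda>i. g (ws ! i)))
      \<le> second_largest_eigenvalue (mat m m (\<lambda>(i, j). a i j))
        * dotp m (\<lambda>i. g (ws ! i)) (\<lambda>i. g (ws ! i))"
  proof (rule second_largest_eigenvalue_bound)
    show "(\<Sum>j<m. a i j) = real n * real D" if "i < m" for i
    proof -
      have "ws ! i \<in> ridges" using that ws(2) by (metis m_def nth_mem)
      then show ?thesis unfolding a_def sum_ws by (rule row_sum_adj)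
    qed
  qed (use top g in \<open>simp_all add: a_def adj_commute sum_ws\<close>)
  ultimately show ?thesis
    unfolding form norm dirichlet_form by (simp add: algebra_simps)
qed

lemma H_const_lower_bound:
  assumes conn: "connected_complex X" "pure_complex X" "has_dimension X n"
    and ws: "distinct ws" "set ws = ridges"
    and lam: "lam = second_largest_eigenvalue (adjacency_matrix ws (embedded_edges X n))"
    and k: "k = (n + 1) div 2"
  shows "2 * real (min_face_degree X n) * (real n * real D - lam)
      / (real (card ridges) * real n * real k * (real n + 1 - real k)) \<le> H_const X n"
proof -
  define V where "V = vertices X"
  define K where "K = real k * (real n + 1 - real k)"
  define W where "W = real (card ridges)"
  define \<delta> where "\<delta> = real (min_face_degree X n)"
  define gap where "gap = real n * real D - lam"
  let ?Q = "\<lambda>A. real (card V) * real (card (crossing_faces X n A (V - A))) / (real (card A) * real (card (V - A)))"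
  let ?S = "{A. A \<subseteq> V \<and> 0 < card A \<and> card A < card V}"
  have finV: "finite V" using finite_vertices by (simp add: V_def)
  have "k \<ge> 1" using n_pos by (simp add: k)
  then have "K > 0" using n_pos by (simp add: K_def k)
  have "X \<noteq> {}" using conn(3) by (simp add: has_dimension_def)
  then obtain s where "s \<in> X" by blast
  then obtain f where f: "f \<in> top_faces" using face_subset_top_face conn by metis
  then have "f \<subseteq> V" "card f = n + 1" by (auto simp: V_def vertices_def faces_iff)
  then have "card V \<ge> n + 1" using finV card_mono by metis
  have "facets f \<noteq> {}" using card_facets[OF f] by auto
  then have "W > 0" by (auto simp: W_def facets_def card_gt_0_iff)
  have \<delta>: "\<delta> * real (card V) \<le> real n * W" "\<delta> \<ge> 0"
    using min_face_degree_bound by (simp_all add: \<delta>_def V_def W_def flip: of_nat_mult)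
  have bound: "2 * \<delta> * gap / (W * real n * K) \<le> ?Q A" if A: "A \<in> ?S" for A
  proof (cases "gap \<le> 0")
    \<comment> \<open>The left side is at most zero here, while the cut quotient is
      nonnegative.\<close>
    case True
    have "2 * \<delta> * gap / (W * real n * K) \<le> 0"
      using True \<delta>(2) \<open>W > 0\<close> \<open>K > 0\<close> by (intro divide_nonpos_nonneg mult_nonneg_nonpos) auto
    also have "0 \<le> ?Q A" by simp
    finally show ?thesis .
  next
    case False
    define C where "C = real (card (crossing_faces X n A (V - A)))"
    \<comment> \<open>The mean of the test function: subtracting it gives sum zero and leaves all
      differences unchanged.\<close>
    define c where "c = (\<Sum>s\<in>ridges. real (card (s \<inter> A))) / W"
    have "A \<noteq> {}" "A \<noteq> vertices X" "A \<subseteq> vertices X" using A by (auto simp: V_def)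
    then obtain s t where st: "s \<in> ridges" "t \<in> ridges" "card (s \<inter> A) \<noteq> card (t \<inter> A)"
      using ridges_with_distinct_traces[OF conn, of A] by metis
    have "1 / 2 \<le> (\<Sum>s\<in>ridges. (real (card (s \<inter> A)) - c)\<^sup>2)"
      using st by (intro half_le_square_deviation) auto
    then have "2 * gap * (1 / 2) \<le> 2 * gap * (\<Sum>s\<in>ridges. (real (card (s \<inter> A)) - c)\<^sup>2)"
      using False by (intro mult_left_mono) auto
    also have "\<dots> \<le> (\<Sum>s\<in>ridges. \<Sum>t\<in>ridges. adj s t * ((real (card (s \<inter> A)) - c) - (real (card (t \<inter> A)) - c))\<^sup>2)"
      unfolding gap_def lam using ws
    proof (rule spectral_gap)
      show "(\<Sum>s\<in>ridges. real (card (s \<inter> A)) - c) = 0"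
        using \<open>W > 0\<close> by (simp add: sum_subtractf c_def W_def)
    qed
    also have "\<dots> \<le> 2 * C * K"
      using cut_dirichlet_bound[OF V_def, of A] by (simp add: C_def K_def k)
    finally have gap_le: "gap \<le> 2 * C * K" by simp
    have ab: "real (card V) = real (card A) + real (card (V - A))"
      using A card_Int_Diff[OF finV, of A] by (simp add: Int_absorb1)
    have pos: "real (card A) > 0" "real (card (V - A)) > 0" using A ab by auto
    \<comment> \<open>Three estimates are chained: minimum degree against average degree, the gap
      against the number of crossing faces, and finally the arithmetic-geometric mean inequality for
      the two sides of the cut.\<close>
    have "2 * \<delta> * gap / (W * real n * K) = (2 * gap / K) * (\<delta> / (real n * W))" by (simp add: mult_ac)
    also have "\<dots> \<le> (2 * gap / K) * (1 / real (card V))"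
      using False \<open>K > 0\<close> \<open>W > 0\<close> \<delta>(1) n_pos ab pos
      by (intro mult_left_mono) (auto simp: field_simps)
    also have "\<dots> \<le> (4 * C) * (1 / real (card V))"
      using gap_le \<open>K > 0\<close> by (intro mult_right_mono) (auto simp: field_simps)
    also have "\<dots> = C * (4 / real (card V))" by simp
    also have "\<dots> \<le> C * (real (card V) / (real (card A) * real (card (V - A))))"
    proof (intro mult_left_mono)
      have "4 * (real (card A) * real (card (V - A))) \<le> real (card V) * real (card V)"
        using zero_le_power2[of "real (card A) - real (card (V - A))"]
        by (simp add: ab power2_eq_square algebra_simps)
      then show "4 / real (card V) \<le> real (card V) / (real (card A) * real (card (V - A)))"
        using pos ab by (simp add: divide_le_eq le_divide_eq mult_ac)
    qed (simp add: C_def)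
    finally show ?thesis by (simp add: C_def mult_ac)
  qed
  have "finite ?S" using finV by simp
  \<comment> \<open>The minimum needs at least one admissible cut; a single vertex is one, since
    there are at least \<open>n + 1 > 1\<close> vertices.\<close>
  moreover have "?S \<noteq> {}"
  proof -
    obtain v where "v \<in> V" using \<open>card V \<ge> n + 1\<close> by fastforce
    then have "{v} \<in> ?S" using \<open>card V \<ge> n + 1\<close> n_pos by simp
    then show ?thesis by blast
  qed
  ultimately have "2 * \<delta> * gap / (W * real n * K) \<le> Min (?Q ` ?S)"
    using bound by (subst Min_ge_iff) auto
  then show ?thesis
    by (simp add: H_const_def Let_def V_def \<delta>_def gap_def W_def K_def mult.assoc)
qed

end

theorem theorem1p3:
  fixes X :: "'v set set" and n D k :: nat and ws :: "'v set list" and lam :: real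
  assumes "n > 2"
    and "finite_simplicial_complex X"
    and "connected_complex X"
    and "pure_complex X"
    and "has_dimension X n"
    and "D > 0"
    and "\<forall>w\<in>faces X (n - 1). card {f \<in> faces X n. w \<subseteq> f} = D"
    and "distinct ws" and "set ws = faces X (n - 1)"
    and "lam = second_largest_eigenvalue (adjacency_matrix ws (embedded_edges X n))"
    and "k = nat \<lfloor>(real n + 1) / 2\<rfloor>"
  shows "2 * real (min_face_degree X n) * (real n * real D - lam)
           / (real (card (faces X (n - 1))) * real n * real k * (real n + 1 - real k))
         \<le> H_const X n"
proof -
  interpret codegree_regular_complex X n D
    using assms by unfold_locales auto
  have "\<lfloor>(real n + 1) / 2\<rfloor> = (int n + 1) div 2"
    using floor_divide_of_int_eq[of "int n + 1" 2, where 'a = real] by simp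
  also have "\<dots> = int ((n + 1) div 2)" by simp
  finally have "k = (n + 1) div 2" using assms(11) by (simp only: nat_int)
  then show ?thesis by (rule H_const_lower_bound[OF assms(3-5,8-10)])
qed

end
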